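(* Let $T=T(D)$ be a real-valued test statistic with $\Pr_k(T\ge 0)=1$ for $k\in\{0,1\}$, where $H_0$ is rejected when $T>C$ for a test threshold $C$. Then $T$ is most powerful (MP) for testing $H_0$ against $H_1$ if and only if, for every real-valued statistic $A=A(D)$, $$f_1^{T,A}(u,v)=u\,f_0^{T,A}(u,v)\quad\text{for all } u\ge 0,\ v\in\mathbb{R}.$$
   Context: Setting: $D$ is the observed data, taking values in a measurable space $(\mathbb{X},\Upsilon)$ with a $\sigma$-finite measure $\tau$. A simple null hypothesis $H_0$ is tested against a simple alternative $H_1$. Under $H_k$ ($k\in\{0,1\}$), $D$ has distribution $\Pr_k$ with density $f_k$ with respect to $\tau$, and $f_0(x)>0$, $f_1(x)>0$ for all $x\in\mathbb{X}$. $\mathrm{E}_k$ is expectation under $\Pr_k$. A statistic is a measurable real-valued function of $D$. The likelihood ratio statistic is $\Lambda=\Lambda(D)=f_1(D)/f_0(D)$. Densities of statistics: for statistics $A,B$, $f_k^{A,B}(u,v)$ is the joint density of $(A(D),B(D))$ under $H_k$, and $f_k^{A}(u)$ is the density of $A(D)$ under $H_k$. For each statistic or pair of statistics, the densities for $k=0$ and $k=1$ are taken with respect to a common $\sigma$-finite measure (Lebesgue measure when such densities exist). Identities between densities are understood almost everywhere. Most powerful: a test statistic $T$ rejecting when $T>C$ is most powerful if its test has the greatest power $\Pr_1(T>C)$ among all $D$-based tests of the same size; $\Lambda$ is such a statistic. Normalization convention: MP statistics are taken in likelihood-ratio form. That is, if a statistic $S=L(\Lambda)$ with $L$ increasing with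 inverse $W$ is to be used, it is replaced by $T=W(S)=\Lambda$, and this $T$ is called MP. Accordingly, "$T$ is MP" means $T(D)=\Lambda(D)$ with probability one (under $\Pr_0$, equivalently under $\Pr_1$). *)

theory Defs
  imports "HOL-Probability.Probability"
begin

definition data_distr :: "'a measure \<Rightarrow> ('a \<Rightarrow> real) \<Rightarrow> 'a measure" where
  "data_distr \<tau> f = density \<tau> (\<lambda>x. ennreal (f x))"

definition simple_testing :: "'a measure \<Rightarrow> ('a \<Rightarrow> real) \<Rightarrow> ('a \<Rightarrow> real) \<Rightarrow> bool" where
  "simple_testing \<tau> f0 f1 \<longleftrightarrow>
     sigma_finite_measure \<tau> \<and>
     f0 \<in> borel_measurable \<tau> \<and> f1 \<in> borel_measurable \<tau> \<and>
     (\<forall>x\<in>space \<tau>. 0 < f0 x \<and> 0 < f1 x) \<and>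
     prob_space (data_distr \<tau> f0) \<and> prob_space (data_distr \<tau> f1)"

definition likelihood_ratio :: "('a \<Rightarrow> real) \<Rightarrow> ('a \<Rightarrow> real) \<Rightarrow> 'a \<Rightarrow> real" where
  "likelihood_ratio f0 f1 x = f1 x / f0 x"

text \<open>Most powerful statistics are normalised to likelihood-ratio form: a statistic that is an
  increasing function of the likelihood ratio \<open>\<Lambda>\<close> is replaced by \<open>\<Lambda>\<close> itself before it is called
  most powerful. Under this convention a statistic is most powerful iff it equals \<open>\<Lambda>\<close> almost
  surely; since both densities are positive, the null sets under the two hypotheses agree, so it
  does not matter that the null distribution is used here.\<close>

definition most_powerful ::
    "'a measure \<Rightarrow> ('a \<Rightarrow> real) \<Rightarrow> ('a \<Rightarrow> real) \<Rightarrow> ('a \<Rightarrow> real) \<Rightarrow> bool" where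
  "most_powerful \<tau> f0 f1 T \<longleftrightarrow>
     (AE x in data_distr \<tau> f0. T x = likelihood_ratio f0 f1 x)"

text \<open>\<open>g0\<close> and \<open>g1\<close> are joint densities of the pair \<open>(A, B)\<close> under \<open>P0\<close> and \<open>P1\<close>, both taken with
  respect to the same \<open>\<sigma>\<close>-finite Borel measure \<open>\<nu>\<close> on the plane. This measure need not be a
  product measure or Lebesgue measure: for instance, the law of \<open>(T, T)\<close> lives on the diagonal.\<close>

definition joint_densities ::
    "'a measure \<Rightarrow> 'a measure \<Rightarrow> ('a \<Rightarrow> real) \<Rightarrow> ('a \<Rightarrow> real) \<Rightarrow>
     (real \<times> real) measure \<Rightarrow> (real \<times> real \<Rightarrow> real) \<Rightarrow> (real \<times> real \<Rightarrow> real) \<Rightarrow> bool" where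
  "joint_densities P0 P1 A B \<nu> g0 g1 \<longleftrightarrow>
     sigma_finite_measure \<nu> \<and> sets \<nu> = sets borel \<and>
     (\<forall>p. 0 \<le> g0 p) \<and> (\<forall>p. 0 \<le> g1 p) \<and>
     distributed P0 \<nu> (\<lambda>x. (A x, B x)) (\<lambda>p. ennreal (g0 p)) \<and>
     distributed P1 \<nu> (\<lambda>x. (A x, B x)) (\<lambda>p. ennreal (g1 p))"

text \<open>Such densities exist for every pair of statistics, so a hypothesis that supplies them for
  all pairs is not restrictive.\<close>

lemma joint_densities_exist:
  assumes st: "simple_testing \<tau> f0 f1"
    and A: "A \<in> borel_measurable \<tau>" and B: "B \<in> borel_measurable \<tau>"
  shows "\<exists>\<nu> g0 g1. joint_densities (data_distr \<tau> f0) (data_distr \<tau> f1) A B \<nu> g0 g1"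
proof -
  let ?P0 = "data_distr \<tau> f0" and ?P1 = "data_distr \<tau> f1"
  let ?X = "\<lambda>x. (A x, B x)"
  let ?N = "distr ?P0 borel ?X" and ?M = "distr ?P1 borel ?X"
  have f [measurable]: "f0 \<in> borel_measurable \<tau>" "f1 \<in> borel_measurable \<tau>"
    and pos: "\<And>x. x \<in> space \<tau> \<Longrightarrow> 0 < f0 x \<and> 0 < f1 x"
    using st by (auto simp: simple_testing_def)
  interpret P0: prob_space ?P0 using st by (simp add: simple_testing_def)
  interpret P1: prob_space ?P1 using st by (simp add: simple_testing_def)
  have X0: "?X \<in> measurable ?P0 borel" and X1: "?X \<in> measurable ?P1 borel"
    using A B by (auto simp: data_distr_def)
  interpret N: prob_space ?N by (rule P0.prob_space_distr[OF X0])
  interpret M: prob_space ?M by (rule P1.prob_space_distr[OF X1])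
  have null: "emeasure ?P1 S = 0" if "emeasure ?P0 S = 0" "S \<in> sets \<tau>" for S
  proof -
    have "S \<in> null_sets ?P0" using that by (auto simp: data_distr_def)
    then have "AE x in \<tau>. x \<in> S \<longrightarrow> ennreal (f0 x) = 0"
      unfolding data_distr_def by (subst (asm) null_sets_density_iff) auto
    then have "AE x in \<tau>. x \<in> S \<longrightarrow> ennreal (f1 x) = 0"
      by (rule AE_mp) (auto intro!: AE_I2 dest!: pos simp: ennreal_eq_0_iff)
    then have "S \<in> null_sets ?P1"
      unfolding data_distr_def using that(2) by (subst null_sets_density_iff) auto
    then show ?thesis by auto
  qed
  have ac: "absolutely_continuous ?N ?M"
    unfolding absolutely_continuous_def
  proof
    fix S assume SN: "S \<in> null_sets ?N"
    then have S: "S \<in> sets borel" by auto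
    have "emeasure ?P0 (?X -` S \<inter> space ?P0) = emeasure ?N S"
      by (rule emeasure_distr[OF X0 S, symmetric])
    also have "\<dots> = 0" using SN by auto
    finally have "emeasure ?P0 (?X -` S \<inter> space ?P0) = 0" .
    moreover have "?X -` S \<inter> space ?P0 \<in> sets \<tau>"
      using measurable_sets[OF X0 S] by (simp add: data_distr_def)
    ultimately have "emeasure ?P1 (?X -` S \<inter> space ?P0) = 0" using null by blast
    then have "emeasure ?M S = 0"
      unfolding emeasure_distr[OF X1 S] by (simp add: data_distr_def)
    then show "S \<in> null_sets ?M" using S by auto
  qed
  obtain D where D: "D \<in> borel_measurable ?N" "AE x in ?N. RN_deriv ?N ?M x = ennreal (D x)"
      "\<And>x. 0 \<le> D x"
  proof (rule N.real_RN_deriv[OF M.finite_measure_axioms ac])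
    show "sets ?M = sets ?N" by simp
  qed blast
  have "?M = density ?N (RN_deriv ?N ?M)"
    using N.density_RN_deriv[OF ac] by simp
  also have "\<dots> = density ?N (\<lambda>x. ennreal (D x))"
    using D by (intro density_cong) auto
  finally have M: "distr ?P1 ?N ?X = density ?N (\<lambda>x. ennreal (D x))"
    by (simp cong: distr_cong)
  have N: "distr ?P0 ?N ?X = density ?N (\<lambda>x. ennreal 1)"
    by (simp add: density_1 cong: distr_cong)
  have "joint_densities ?P0 ?P1 A B ?N (\<lambda>_. 1) D"
    unfolding joint_densities_def distributed_def
    using D M N X0 X1 N.sigma_finite_measure_axioms by auto
  then show ?thesis by blast
qed

end

theory Submission
  imports Defs
begin

text \<open>
  Write \<open>X = (T, A)\<close>. The identity \<open>g1 (u, v) = u * g0 (u, v)\<close> says that the law of \<open>X\<close> under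
  the alternative has density \<open>(u, v) \<mapsto> u\<close> with respect to the law of \<open>X\<close> under the null
  (\<open>joint_densities_eq_iff\<close>), a statement in which the dominating measure no longer occurs. On the
  data space, the alternative has density \<open>\<Lambda>\<close> with respect to the null
  (\<open>data_distr_alternative\<close>), and a density that is a function of \<open>X\<close> is inherited by the law of
  \<open>X\<close> (\<open>density_distr\<close>).

  If \<open>T = \<Lambda>\<close> almost surely, then \<open>\<Lambda>\<close> is, for every \<open>A\<close>, the first coordinate of \<open>X\<close>, so the
  identity follows. Conversely, the single choice \<open>A = \<Lambda>\<close> suffices: the law of \<open>(T, \<Lambda>)\<close> under
  the alternative then has both coordinates as densities with respect to the law under the null.
  Since densities are almost everywhere unique, the two coordinates agree almost surely.
\<close>

lemma likelihood_ratio_measurable: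
  assumes "simple_testing \<tau> f0 f1"
  shows "likelihood_ratio f0 f1 \<in> borel_measurable \<tau>"
proof -
  have [measurable]: "f0 \<in> borel_measurable \<tau>" "f1 \<in> borel_measurable \<tau>"
    using assms by (simp_all add: simple_testing_def)
  show ?thesis
    unfolding likelihood_ratio_def[abs_def] by measurable
qed

lemma data_distr_alternative:
  assumes "simple_testing \<tau> f0 f1"
  shows "data_distr \<tau> f1 =
    density (data_distr \<tau> f0) (\<lambda>x. ennreal (likelihood_ratio f0 f1 x))"
proof -
  have [measurable]: "f0 \<in> borel_measurable \<tau>" "f1 \<in> borel_measurable \<tau>"
      "likelihood_ratio f0 f1 \<in> borel_measurable \<tau>"
    and pos: "\<And>x. x \<in> space \<tau> \<Longrightarrow> 0 < f0 x \<and> 0 < f1 x"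
    using assms by (auto simp: simple_testing_def intro: likelihood_ratio_measurable)
  have "density (data_distr \<tau> f0) (\<lambda>x. ennreal (likelihood_ratio f0 f1 x)) =
      density \<tau> (\<lambda>x. ennreal (f0 x) * ennreal (likelihood_ratio f0 f1 x))"
    unfolding data_distr_def by (rule density_density_eq) measurable
  also have "\<dots> = density \<tau> (\<lambda>x. ennreal (f1 x))"
  proof (intro density_cong AE_I2)
    fix x assume "x \<in> space \<tau>"
    then show "ennreal (f0 x) * ennreal (likelihood_ratio f0 f1 x) = ennreal (f1 x)"
      using pos[of x] by (simp add: likelihood_ratio_def ennreal_mult'[symmetric])
  qed measurable
  finally show ?thesis by (simp add: data_distr_def)
qed

text \<open>The dominating measure can be eliminated from the identity between the joint densities.
  Nonnegativity of \<open>A\<close> under \<open>P1\<close> takes care of the half-plane \<open>u < 0\<close>, where the identity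
  is not required: there \<open>g1\<close> vanishes almost everywhere, as does \<open>ennreal u\<close>.\<close>

lemma joint_densities_eq_iff:
  assumes jd: "joint_densities P0 P1 A B \<nu> g0 g1"
    and A_nonneg: "AE x in P1. 0 \<le> A x"
  shows "(AE (u, v) in \<nu>. 0 \<le> u \<longrightarrow> g1 (u, v) = u * g0 (u, v)) \<longleftrightarrow>
    distr P1 borel (\<lambda>x. (A x, B x)) =
      density (distr P0 borel (\<lambda>x. (A x, B x))) (\<lambda>p. ennreal (fst p))"
    (is "?identity \<longleftrightarrow> distr P1 borel ?X = _")
proof -
  have sets[measurable_cong]: "sets \<nu> = sets borel"
    and g_nonneg: "\<And>p. 0 \<le> g0 p" "\<And>p. 0 \<le> g1 p"
    and dist0: "distributed P0 \<nu> ?X (\<lambda>p. ennreal (g0 p))"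
    and dist1: "distributed P1 \<nu> ?X (\<lambda>p. ennreal (g1 p))"
    using jd by (auto simp: joint_densities_def)
  interpret sigma_finite_measure \<nu>
    using jd by (simp add: joint_densities_def)
  have [measurable]: "(\<lambda>p. ennreal (g0 p)) \<in> borel_measurable \<nu>"
      "(\<lambda>p. ennreal (g1 p)) \<in> borel_measurable \<nu>"
    using dist0 dist1 by (auto dest: distributed_borel_measurable)
  have [measurable]: "fst \<in> borel_measurable \<nu>"
    unfolding measurable_cong_sets[OF sets refl] by (simp add: borel_prod[symmetric])
  have law0: "distr P0 borel ?X = density \<nu> (\<lambda>p. ennreal (g0 p))"
    using distributed_distr_eq_density[OF dist0] sets by (simp cong: distr_cong)
  have law1: "distr P1 borel ?X = density \<nu> (\<lambda>p. ennreal (g1 p))"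
    using distributed_distr_eq_density[OF dist1] sets by (simp cong: distr_cong)
  have X1: "?X \<in> measurable P1 \<nu>"
    using dist1 by (rule distributed_measurable)
  have "AE p in distr P1 \<nu> ?X. 0 \<le> fst p"
  proof (subst AE_distr_iff[OF X1])
    show "{p \<in> space \<nu>. 0 \<le> fst p} \<in> sets \<nu>"
      by measurable
    show "AE x in P1. 0 \<le> fst (A x, B x)"
      using A_nonneg by simp
  qed
  then have vanish: "AE p in \<nu>. 0 < g1 p \<longrightarrow> 0 \<le> fst p"
    unfolding distributed_distr_eq_density[OF dist1] by (subst (asm) AE_density) auto
  have "?identity \<longleftrightarrow> (AE p in \<nu>. ennreal (g1 p) = ennreal (g0 p) * ennreal (fst p))"
  proof
    assume ?identity
    with vanish show "AE p in \<nu>. ennreal (g1 p) = ennreal (g0 p) * ennreal (fst p)"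
    proof eventually_elim
      case (elim p)
      show ?case
      proof (cases "0 \<le> fst p")
        case True
        then show ?thesis
          using elim g_nonneg by (cases p) (simp add: ennreal_mult mult.commute)
      next
        case False
        then have "g1 p = 0"
          using elim(1) g_nonneg(2)[of p] by linarith
        then show ?thesis
          using False by (simp add: ennreal_neg)
      qed
    qed
  next
    assume "AE p in \<nu>. ennreal (g1 p) = ennreal (g0 p) * ennreal (fst p)"
    then show ?identity
    proof eventually_elim
      case (elim p)
      then show ?case
        using g_nonneg by (cases p) (auto simp: ennreal_mult[symmetric] mult.commute)
    qed
  qed
  also have "\<dots> \<longleftrightarrow> density \<nu> (\<lambda>p. ennreal (g1 p)) =
      density \<nu> (\<lambda>p. ennreal (g0 p) * ennreal (fst p))"
    by (intro density_unique_iff[symmetric]) measurable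
  also have "density \<nu> (\<lambda>p. ennreal (g0 p) * ennreal (fst p)) =
      density (distr P0 borel ?X) (\<lambda>p. ennreal (fst p))"
    unfolding law0 by (intro density_density_eq[symmetric]) measurable
  finally show ?thesis
    unfolding law1 .
qed

theorem proposition2p2:
  fixes \<tau> :: "'a measure"
    and f0 f1 T :: "'a \<Rightarrow> real"
    and \<nu> :: "('a \<Rightarrow> real) \<Rightarrow> (real \<times> real) measure"
    and g0 g1 :: "('a \<Rightarrow> real) \<Rightarrow> real \<times> real \<Rightarrow> real"
  assumes "simple_testing \<tau> f0 f1"
    and "T \<in> borel_measurable \<tau>"
    and "\<P>(x in data_distr \<tau> f0. 0 \<le> T x) = 1"
    and "\<P>(x in data_distr \<tau> f1. 0 \<le> T x) = 1"
    and "\<And>A. A \<in> borel_measurable \<tau> \<Longrightarrow>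
           joint_densities (data_distr \<tau> f0) (data_distr \<tau> f1) T A (\<nu> A) (g0 A) (g1 A)"
  shows "most_powerful \<tau> f0 f1 T \<longleftrightarrow>
         (\<forall>A\<in>borel_measurable \<tau>. AE (u, v) in \<nu> A. 0 \<le> u \<longrightarrow> g1 A (u, v) = u * g0 A (u, v))"
proof -
  let ?P0 = "data_distr \<tau> f0" and ?P1 = "data_distr \<tau> f1"
  let ?L = "likelihood_ratio f0 f1"
  interpret P0: prob_space ?P0
    using assms(1) by (simp add: simple_testing_def)
  interpret P1: prob_space ?P1
    using assms(1) by (simp add: simple_testing_def)
  have sets[measurable_cong]: "sets ?P0 = sets \<tau>" "sets ?P1 = sets \<tau>"
    by (simp_all add: data_distr_def)
  note [measurable] = assms(2) likelihood_ratio_measurable[OF assms(1)]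
  have T_nonneg0: "AE x in ?P0. 0 \<le> T x"
    using assms(3) by (subst P0.prob_Collect_eq_1[symmetric]) auto
  have T_nonneg1: "AE x in ?P1. 0 \<le> T x"
    using assms(4) by (subst P1.prob_Collect_eq_1[symmetric]) auto
  have L_nonneg: "AE x in ?P0. 0 \<le> ?L x"
    using assms(1)
    by (intro AE_I2) (auto simp: simple_testing_def likelihood_ratio_def data_distr_def
        intro: less_imp_le)
  have coord[measurable]: "(\<lambda>p :: real \<times> real. ennreal (fst p)) \<in> borel_measurable borel"
      "(\<lambda>p :: real \<times> real. ennreal (snd p)) \<in> borel_measurable borel"
    by (simp_all add: borel_prod[symmetric])
  note identity_iff = joint_densities_eq_iff[OF assms(5) T_nonneg1]
  show ?thesis
  proof
    assume "most_powerful \<tau> f0 f1 T"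
    then have "AE x in ?P0. T x = ?L x"
      by (simp add: most_powerful_def)
    then have "density ?P0 (\<lambda>x. ennreal (?L x)) = density ?P0 (\<lambda>x. ennreal (T x))"
      by (intro density_cong) auto
    then have P1_eq: "?P1 = density ?P0 (\<lambda>x. ennreal (T x))"
      using data_distr_alternative[OF assms(1)] by simp
    show "\<forall>A\<in>borel_measurable \<tau>.
        AE (u, v) in \<nu> A. 0 \<le> u \<longrightarrow> g1 A (u, v) = u * g0 A (u, v)"
    proof
      fix A :: "'a \<Rightarrow> real"
      assume A[measurable]: "A \<in> borel_measurable \<tau>"
      have X: "(\<lambda>x. (T x, A x)) \<in> measurable ?P0 borel"
        by measurable
      show "AE (u, v) in \<nu> A. 0 \<le> u \<longrightarrow> g1 A (u, v) = u * g0 A (u, v)"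
        unfolding identity_iff[OF A] density_distr[OF coord(1) X] P1_eq by simp
    qed
  next
    assume "\<forall>A\<in>borel_measurable \<tau>.
        AE (u, v) in \<nu> A. 0 \<le> u \<longrightarrow> g1 A (u, v) = u * g0 A (u, v)"
    then have "AE (u, v) in \<nu> ?L. 0 \<le> u \<longrightarrow> g1 ?L (u, v) = u * g0 ?L (u, v)"
      using likelihood_ratio_measurable[OF assms(1)] by blast
    then have law_fst: "distr ?P1 borel (\<lambda>x. (T x, ?L x)) =
        density (distr ?P0 borel (\<lambda>x. (T x, ?L x))) (\<lambda>p. ennreal (fst p))"
      unfolding identity_iff[OF likelihood_ratio_measurable[OF assms(1)]] .
    have X: "(\<lambda>x. (T x, ?L x)) \<in> measurable ?P0 borel"
      by measurable
    interpret N: prob_space "distr ?P0 borel (\<lambda>x. (T x, ?L x))"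
      by (rule P0.prob_space_distr[OF X])
    have law_snd: "distr ?P1 borel (\<lambda>x. (T x, ?L x)) =
        density (distr ?P0 borel (\<lambda>x. (T x, ?L x))) (\<lambda>p. ennreal (snd p))"
      unfolding density_distr[OF coord(2) X] data_distr_alternative[OF assms(1)] by simp
    have "AE p in distr ?P0 borel (\<lambda>x. (T x, ?L x)). ennreal (fst p) = ennreal (snd p)"
      using law_fst law_snd by (intro N.density_unique) auto
    then have "AE x in ?P0. ennreal (T x) = ennreal (?L x)"
      using AE_distrD[OF X] by fastforce
    with T_nonneg0 L_nonneg have "AE x in ?P0. T x = ?L x"
      by eventually_elim simp
    then show "most_powerful \<tau> f0 f1 T"
      by (simp add: most_powerful_def)
  qed
qed

end
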